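(* Let $\sigma:\mathbb{R}\to\mathbb{R}$ be an activation function of sigmoidal type and let $\mathcal{F}_{fin}=\{f\in\mathcal{C}: D(f)\text{ is finite}\}$ be the family of all real-valued functions defined on finite metric spaces. Then the shallow neural network $\mathcal{N}_\sigma(\mathcal{F}_{fin})$ generated by $\sigma$ and $\mathcal{F}_{fin}$ is dense in $\mathcal{C}$ (with respect to $d_{GH^0}$).
   Context: Metric spaces are nonempty. $\mathcal{M}$ is the collection of all compact metric spaces. For a metric space $X$, $\mathcal{C}(X)$ is the set of continuous functions $f:X\to\mathbb{R}$, and $\|f\|_\infty=\sup_{x\in X}|f(x)|$. Put $\mathcal{C}=\bigcup_{X\in\mathcal{M}}\mathcal{C}(X)$; the domain map $D:\mathcal{C}\to\mathcal{M}$ sends $f$ to its domain. For $\mathcal{F}\subset\mathcal{C}$ and $X\in\mathcal{M}$, $\mathcal{F}(X)=\mathcal{F}\cap\mathcal{C}(X)$. An activation function is a continuous function $\sigma:\mathbb{R}\to\mathbb{R}$; it is of sigmoidal type if $\lim_{t\to-\infty}\sigma(t)=0$ and $\lim_{t\to\infty}\sigma(t)=1$. For $F\subset\mathcal{C}(X)$, $N_\sigma(F)$ is $\emptyset$ if $F=\emptyset$, and otherwise the collection of functions $g:X\to\mathbb{R}$ of the form $g(x)=\sum_{j=1}^N a_j\sigma(f_j(x)+\theta_j)$ for all $x\in X$, with $N\in\mathbb{N}$, $a_j,\theta_j\in\mathbb{R}$, $f_j\in F$. For $\mathcal{F}\subset\mathcal{C}$, the shallow neural network generated by $\sigma$ and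 $\mathcal{F}$ is $\mathcal{N}_\sigma(\mathcal{F})=\bigcup_{X\in\mathcal{M}}N_\sigma(\mathcal{F}(X))$. For $X,Y\in\mathcal{M}$ and $\epsilon>0$, a (not necessarily continuous) map $i:X\to Y$ is an $\epsilon$-isometry if $|d(i(x),i(x'))-d(x,x')|\le\epsilon$ for all $x,x'\in X$, and for every $y\in Y$ there is $x\in X$ with $d(i(x),y)\le\epsilon$. The $C^0$-Gromov-Hausdorff distance on $\mathcal{C}$ is $d_{GH^0}(f,g)=\inf\{\epsilon>0:$ there exist $\epsilon$-isometries $i:D(f)\to D(g)$ and $j:D(g)\to D(f)$ with $\|g\circ i-f\|_\infty\le\epsilon$ and $\|g-f\circ j\|_\infty\le\epsilon\}$. It generates a topology on $\mathcal{C}$ via its open balls (a set is open iff it contains an open ball around each of its points). Density in $\mathcal{C}$ is with respect to $d_{GH^0}$. *)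

theory Defs
  imports "HOL-Analysis.Analysis"
begin

(* The points of all spaces are drawn from an arbitrary type 'a.  Every compact metric space has
   at most continuum many points, so for 'a = real the collection already contains an isometric
   copy of each of them. *)
definition compact_spaces :: "'a metric set"  where
  "compact_spaces = {X. mspace X \<noteq> {} \<and> compact_space (mtopology_of X)}"

(* HOL functions are total; extensionality (value undefined off the space) makes an element
   determined by its values on the space. *)
definition cont_fun :: "'a metric \<Rightarrow> ('a \<Rightarrow> real) set" where
  "cont_fun X = {f \<in> extensional (mspace X). continuous_map (mtopology_of X) euclideanreal f}"

(* A function is stored together with its domain, as a pair (X, f). *)
type_synonym 'a dfun = "'a metric \<times> ('a \<Rightarrow> real)"

definition all_cont :: "'a dfun set" where
  "all_cont = (SIGMA X : compact_spaces. cont_fun X)"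

definition Dom :: "'a dfun \<Rightarrow> 'a metric" where
  "Dom f = fst f"

definition slice :: "'a dfun set \<Rightarrow> 'a metric \<Rightarrow> ('a \<Rightarrow> real) set" where
  "slice \<F> X = {f \<in> cont_fun X. (X, f) \<in> \<F>}"

definition activation :: "(real \<Rightarrow> real) \<Rightarrow> bool" where
  "activation \<sigma> \<longleftrightarrow> continuous_on UNIV \<sigma>"

definition sigmoidal_type :: "(real \<Rightarrow> real) \<Rightarrow> bool" where
  "sigmoidal_type \<sigma> \<longleftrightarrow> (\<sigma> \<longlongrightarrow> 0) at_bot \<and> (\<sigma> \<longlongrightarrow> 1) at_top"

definition net_on :: "(real \<Rightarrow> real) \<Rightarrow> 'a metric \<Rightarrow> ('a \<Rightarrow> real) set \<Rightarrow> ('a \<Rightarrow> real) set" where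
  "net_on \<sigma> X F =
     (if F = {} then {}
      else {g. \<exists>(N::nat) (a :: nat \<Rightarrow> real) (\<theta> :: nat \<Rightarrow> real) (f :: nat \<Rightarrow> 'a \<Rightarrow> real).
              1 \<le> N \<and> (\<forall>j\<in>{1..N}. f j \<in> F) \<and>
              g = (\<lambda>x\<in>mspace X. \<Sum>j=1..N. a j * \<sigma> (f j x + \<theta> j))})"

definition shallow_net :: "(real \<Rightarrow> real) \<Rightarrow> 'a dfun set \<Rightarrow> 'a dfun set" where
  "shallow_net \<sigma> \<F> = (SIGMA X : compact_spaces. net_on \<sigma> X (slice \<F> X))"

definition eps_isometry :: "real \<Rightarrow> 'a metric \<Rightarrow> 'a metric \<Rightarrow> ('a \<Rightarrow> 'a) \<Rightarrow> bool" where
  "eps_isometry \<epsilon> X Y i \<longleftrightarrow>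
     i \<in> mspace X \<rightarrow> mspace Y \<and>
     (\<forall>x\<in>mspace X. \<forall>x'\<in>mspace X. \<bar>mdist Y (i x) (i x') - mdist X x x'\<bar> \<le> \<epsilon>) \<and>
     (\<forall>y\<in>mspace Y. \<exists>x\<in>mspace X. mdist Y (i x) y \<le> \<epsilon>)"

definition sup_norm :: "'a metric \<Rightarrow> ('a \<Rightarrow> real) \<Rightarrow> real" where
  "sup_norm X h = (SUP x\<in>mspace X. \<bar>h x\<bar>)"

(* On all_cont the suprema are over nonempty bounded sets (f and g are bounded, so the possible
   discontinuity of i and j does no harm), and the infimum is over a nonempty set: constant maps
   i and j are admissible for large \<epsilon>. *)
definition dGH0 :: "'a dfun \<Rightarrow> 'a dfun \<Rightarrow> real" where
  "dGH0 f g = Inf {\<epsilon>. 0 < \<epsilon> \<and>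
     (\<exists>i j. eps_isometry \<epsilon> (Dom f) (Dom g) i \<and> eps_isometry \<epsilon> (Dom g) (Dom f) j \<and>
        sup_norm (Dom f) (\<lambda>x. snd g (i x) - snd f x) \<le> \<epsilon> \<and>
        sup_norm (Dom g) (\<lambda>y. snd g y - snd f (j y)) \<le> \<epsilon>)}"

definition GH0_open :: "'a dfun set \<Rightarrow> bool" where
  "GH0_open U \<longleftrightarrow> U \<subseteq> all_cont \<and> (\<forall>f\<in>U. \<exists>r>0. {g \<in> all_cont. dGH0 f g < r} \<subseteq> U)"

definition GH0_topology :: "'a dfun topology" where
  "GH0_topology = topology GH0_open"

lemma istopology_GH0_open: "istopology GH0_open"
  unfolding istopology_def
proof (intro conjI allI impI)
  fix S T :: "'a dfun set"
  assume S: "GH0_open S" and T: "GH0_open T"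
  show "GH0_open (S \<inter> T)"
    unfolding GH0_open_def
  proof (intro conjI ballI)
    show "S \<inter> T \<subseteq> all_cont"
      using S by (auto simp: GH0_open_def)
    fix f assume "f \<in> S \<inter> T"
    then obtain r s where "r > 0" "{g \<in> all_cont. dGH0 f g < r} \<subseteq> S"
      and "s > 0" "{g \<in> all_cont. dGH0 f g < s} \<subseteq> T"
      using S T unfolding GH0_open_def by (meson IntD1 IntD2)
    then have "min r s > 0 \<and> {g \<in> all_cont. dGH0 f g < min r s} \<subseteq> S \<inter> T"
      by auto
    then show "\<exists>r>0. {g \<in> all_cont. dGH0 f g < r} \<subseteq> S \<inter> T"
      by blast
  qed
next
  fix K :: "'a dfun set set"
  assume "\<forall>S\<in>K. GH0_open S"
  then show "GH0_open (\<Union>K)"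
    unfolding GH0_open_def by (meson Sup_least Union_iff Union_upper order_trans)
qed

lemma openin_GH0_topology: "openin GH0_topology U \<longleftrightarrow> GH0_open U"
  by (simp add: GH0_topology_def istopology_GH0_open topology_inverse')

lemma topspace_GH0_topology: "topspace GH0_topology = all_cont"
proof -
  have "GH0_open (all_cont :: 'a dfun set)"
    unfolding GH0_open_def using zero_less_one by blast
  then show ?thesis
    unfolding topspace_def openin_GH0_topology by (auto simp: GH0_open_def)
qed

definition dense_in_GH0 :: "'a dfun set \<Rightarrow> bool" where
  "dense_in_GH0 S \<longleftrightarrow> S \<subseteq> all_cont \<and> GH0_topology closure_of S = all_cont"

definition F_fin :: "'a dfun set" where
  "F_fin = {f \<in> all_cont. finite (mspace (Dom f))}"

end

(* A compact metric space carrying a continuous function is approximated, in the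
   C0-Gromov-Hausdorff sense, by a finite subspace carrying the restriction of that function:
   cover the space by finitely many open sets that are small and on which the function hardly
   varies, take the centres as the subspace, and use the inclusion and a choice of centre as the
   two almost isometries.  On a finite space every function is continuous, so the network
   represents every real function exactly: by the intermediate value theorem sigma takes all
   values in (0,1), and any g with |g| < K is 2K sigma(f) - 2K sigma(c) with sigma(c) = 1/2 and
   sigma(f) = (g + K) / (2K). *)

theory Submission
  imports Defs
begin

lemma sigmoidal_type_range:
  assumes "activation \<sigma>" "sigmoidal_type \<sigma>" and "0 < y" "y < 1"
  obtains t where "\<sigma> t = y"
proof -
  have "eventually (\<lambda>t. \<sigma> t < y) at_bot" "eventually (\<lambda>t. y < \<sigma> t) at_top"
    using assms unfolding sigmoidal_type_def by (auto intro: order_tendstoD)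
  then obtain u v where u: "\<And>t. t \<le> u \<Longrightarrow> \<sigma> t < y" and v: "\<And>t. v \<le> t \<Longrightarrow> y < \<sigma> t"
    unfolding eventually_at_bot_linorder eventually_at_top_linorder by blast
  \<comment> \<open>The two thresholds come in no particular order; \<open>max u v\<close> still
    lies in the upper range and makes the interval nonempty.\<close>
  have "\<sigma> u < y" "y < \<sigma> (max u v)"
    using u v by auto
  moreover have "continuous_on {u..max u v} \<sigma>"
    using assms(1) unfolding activation_def by (rule continuous_on_subset) simp
  ultimately obtain t where "\<sigma> t = y"
    using IVT'[of \<sigma> u y "max u v"] by (metis less_imp_le max.cobounded1)
  then show thesis
    by (rule that)
qed

text \<open>Density includes being a subset of \<open>all_cont\<close>, so the network must consist
  of continuous functions. Sums, shifts and composition with \<sigma> preserve continuity.\<close>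

lemma net_on_subset_cont_fun:
  assumes "activation \<sigma>" and "F \<subseteq> cont_fun X"
  shows "net_on \<sigma> X F \<subseteq> cont_fun X"
proof
  fix g assume "g \<in> net_on \<sigma> X F"
  then obtain N :: nat and a \<theta> :: "nat \<Rightarrow> real" and f :: "nat \<Rightarrow> 'a \<Rightarrow> real"
    where f: "\<And>j. j \<in> {1..N} \<Longrightarrow> f j \<in> F"
      and g: "g = (\<lambda>x\<in>mspace X. \<Sum>j=1..N. a j * \<sigma> (f j x + \<theta> j))"
    unfolding net_on_def by (clarsimp split: if_splits simp del: restrict_apply) (rule that; fastforce)
  have \<sigma>: "continuous_map euclideanreal euclideanreal \<sigma>"
    using assms(1) by (simp add: activation_def)
  have "continuous_map (mtopology_of X) euclideanreal (\<lambda>x. \<sigma> (f j x + \<theta> j))" if "j \<in> {1..N}" for j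
  proof -
    have "continuous_map (mtopology_of X) euclideanreal (f j)"
      using f[OF that] assms(2) by (auto simp: cont_fun_def)
    then have "continuous_map (mtopology_of X) euclideanreal (\<lambda>x. f j x + \<theta> j)"
      by (intro continuous_intros) auto
    from continuous_map_compose[OF this \<sigma>] show ?thesis
      by (simp add: o_def)
  qed
  then have "continuous_map (mtopology_of X) euclideanreal (\<lambda>x. \<Sum>j=1..N. a j * \<sigma> (f j x + \<theta> j))"
    by (intro continuous_map_sum continuous_map_real_mult_left) auto
  then have "continuous_map (mtopology_of X) euclideanreal g"
    by (rule continuous_map_eq) (simp add: g)
  then show "g \<in> cont_fun X"
    by (simp add: cont_fun_def g)
qed

lemma shallow_net_subset_all_cont:
  assumes "activation \<sigma>"
  shows "shallow_net \<sigma> \<F> \<subseteq> all_cont"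
proof -
  have "net_on \<sigma> X (slice \<F> X) \<subseteq> cont_fun X" for X
    using assms by (rule net_on_subset_cont_fun) (auto simp: slice_def)
  then show ?thesis
    unfolding shallow_net_def all_cont_def by (intro Sigma_mono) auto
qed

lemma mtopology_of_finite:
  assumes "finite (mspace X)"
  shows "mtopology_of X = discrete_topology (mspace X)"
proof -
  interpret Metric_space "mspace X" "mdist X"
    by simp
  show ?thesis
    using assms by (intro finite_t1_space_imp_discrete_topology)
      (simp_all add: mtopology_of_def t1_space_mtopology)
qed

lemma finite_in_compact_spaces:
  assumes "finite (mspace X)" "mspace X \<noteq> {}"
  shows "X \<in> compact_spaces"
  using assms by (simp add: compact_spaces_def mtopology_of_finite compact_space_discrete_topology)

lemma cont_fun_finite:
  assumes "finite (mspace X)"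
  shows "cont_fun X = extensional (mspace X)"
  using assms by (simp add: cont_fun_def mtopology_of_finite)

lemma shallow_net_F_fin_finite:
  fixes X :: "'a metric"
  assumes "activation \<sigma>" "sigmoidal_type \<sigma>"
    and X: "finite (mspace X)" "mspace X \<noteq> {}" and g: "g \<in> extensional (mspace X)"
  shows "(X, g) \<in> shallow_net \<sigma> F_fin"
proof -
  have F: "slice F_fin X = extensional (mspace X)"
    using X by (auto simp: slice_def F_fin_def all_cont_def Dom_def cont_fun_finite
        finite_in_compact_spaces)
  \<comment> \<open>The summand 1 makes the bound on \<open>g\<close> strict even where only one
    value is nonzero, and \<open>K\<close> positive. Strictness matters: \<sigma> is only known to
    take the values strictly between 0 and 1.\<close>
  define K where "K = (\<Sum>x\<in>mspace X. \<bar>g x\<bar>) + 1"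
  have K: "\<bar>g x\<bar> < K" if "x \<in> mspace X" for x
    using member_le_sum[OF that, of "\<lambda>x. \<bar>g x\<bar>"] X(1) by (simp add: K_def)
  have K0: "0 < K"
    by (simp add: K_def sum_nonneg add_nonneg_pos)
  have "\<exists>t. \<sigma> t = (g x + K) / (2 * K)" if "x \<in> mspace X" for x
  proof -
    have "0 < (g x + K) / (2 * K)" "(g x + K) / (2 * K) < 1"
      using K[OF that] K0 by (auto simp: field_simps)
    then show ?thesis
      using sigmoidal_type_range[OF assms(1,2)] by metis
  qed
  then obtain h where h: "\<And>x. x \<in> mspace X \<Longrightarrow> \<sigma> (h x) = (g x + K) / (2 * K)"
    by metis
  obtain c where c: "\<sigma> c = 1 / 2"
    using sigmoidal_type_range[OF assms(1,2), of "1 / 2"] by auto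
  \<comment> \<open>Two neurons: the first yields \<open>g x + K\<close>, the constant second one
    yields \<open>- K\<close>. All shifts are 0, since the choice of \<open>h\<close> and
    \<open>c\<close> absorbs them.\<close>
  define f where "f j = (if j = (1::nat) then restrict h (mspace X) else (\<lambda>x\<in>mspace X. c))" for j
  define a where "a j = (if j = (1::nat) then 2 * K else - 2 * K)" for j
  have "{1..2} = {1, 2::nat}"
    by auto
  then have "g = (\<lambda>x\<in>mspace X. \<Sum>j=1..2. a j * \<sigma> (f j x + 0))"
    using g K0 by (intro extensionalityI[of _ "mspace X"]) (auto simp: a_def f_def h c field_simps)
  moreover have "(1::nat) \<le> 2" "\<forall>j\<in>{1..2}. f j \<in> extensional (mspace X)"
    by (simp_all add: f_def)
  ultimately have "\<exists>(N::nat) a \<theta> f. 1 \<le> N \<and> (\<forall>j\<in>{1..N}. f j \<in> extensional (mspace X)) \<and>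
      g = (\<lambda>x\<in>mspace X. \<Sum>j=1..N. a j * \<sigma> (f j x + \<theta> j))"
    by (intro exI[where x = "2::nat"] exI[where x = a] exI[where x = "\<lambda>_. 0"] exI[where x = f]) simp
  then have "g \<in> net_on \<sigma> X (extensional (mspace X))"
    using g unfolding net_on_def by auto
  then show ?thesis
    using X by (simp add: shallow_net_def F finite_in_compact_spaces)
qed

lemma finite_approximation_compact_space:
  assumes X: "X \<in> compact_spaces" and f: "f \<in> cont_fun X" and "0 < \<epsilon>"
  obtains S i where "finite S" "S \<subseteq> mspace X" "i \<in> mspace X \<rightarrow> S"
    and "\<And>x. x \<in> mspace X \<Longrightarrow> mdist X (i x) x < \<epsilon>"
    and "\<And>x. x \<in> mspace X \<Longrightarrow> \<bar>f (i x) - f x\<bar> < \<epsilon>"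
proof -
  interpret Metric_space "mspace X" "mdist X"
    by simp
  \<comment> \<open>Intersecting a preimage with a metric ball lets one finite subcover control both
    the distance to the centre and the variation of \<open>f\<close>.\<close>
  define U where "U s = {x \<in> mspace X. f x \<in> ball (f s) \<epsilon>} \<inter> mball s \<epsilon>" for s
  have "openin (mtopology_of X) {x \<in> mspace X. f x \<in> ball (f s) \<epsilon>}" for s
    using openin_continuous_map_preimage[of "mtopology_of X" euclideanreal f "ball (f s) \<epsilon>"] f
    by (simp add: cont_fun_def)
  then have "openin (mtopology_of X) (U s)" for s
    unfolding U_def by (intro openin_Int) (simp_all add: mtopology_of_def)
  moreover have "mspace X \<subseteq> \<Union> (U ` mspace X)"
    using \<open>0 < \<epsilon>\<close> by (auto simp: U_def)
  moreover have "compact_space (mtopology_of X)"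
    using X by (simp add: compact_spaces_def)
  ultimately obtain \<V> where "finite \<V>" "\<V> \<subseteq> U ` mspace X" "mspace X \<subseteq> \<Union> \<V>"
    unfolding compact_space_alt by (metis (no_types, lifting) image_iff topspace_mtopology_of)
  then obtain S where S: "finite S" "S \<subseteq> mspace X" "mspace X \<subseteq> \<Union> (U ` S)"
    by (metis finite_subset_image)
  then have "\<forall>x\<in>mspace X. \<exists>s. s \<in> S \<and> x \<in> U s"
    by blast
  then obtain i where i: "\<And>x. x \<in> mspace X \<Longrightarrow> i x \<in> S \<and> x \<in> U (i x)"
    by metis
  show thesis
  proof (rule that[OF S(1,2)])
    show "i \<in> mspace X \<rightarrow> S"
      using i by blast
    show "mdist X (i x) x < \<epsilon>" if "x \<in> mspace X" for x
      using i[OF that] by (simp add: U_def)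
    show "\<bar>f (i x) - f x\<bar> < \<epsilon>" if "x \<in> mspace X" for x
      using i[OF that] by (simp add: U_def dist_real_def)
  qed
qed

text \<open>Over a nonempty space a pointwise bound passes to the supremum, and the admissible
  values are bounded below by 0, so each of them bounds the infimum from above.\<close>

lemma dGH0_le:
  assumes "0 < \<epsilon>" "mspace X \<noteq> {}" "mspace Y \<noteq> {}"
    and "eps_isometry \<epsilon> X Y i" "eps_isometry \<epsilon> Y X j"
    and "\<And>x. x \<in> mspace X \<Longrightarrow> \<bar>g (i x) - f x\<bar> \<le> \<epsilon>"
    and "\<And>y. y \<in> mspace Y \<Longrightarrow> \<bar>g y - f (j y)\<bar> \<le> \<epsilon>"
  shows "dGH0 (X, f) (Y, g) \<le> \<epsilon>"
proof -
  have "sup_norm X (\<lambda>x. g (i x) - f x) \<le> \<epsilon>" "sup_norm Y (\<lambda>y. g y - f (j y)) \<le> \<epsilon>"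
    unfolding sup_norm_def using assms by (auto intro: cSUP_least)
  then show ?thesis
    unfolding dGH0_def using assms
    by (intro cInf_lower bdd_belowI[of _ 0] CollectI conjI exI[where x = i] exI[where x = j])
      (auto simp: Dom_def)
qed

text \<open>The map \<open>i\<close> goes to the subspace and the inclusion goes back. Both
  endpoints of a distance move under \<open>i\<close>, so displacements of
  \<open>\<epsilon> / 2\<close> give distortion \<epsilon>. The inclusion preserves distances and
  function values exactly.\<close>

lemma dGH0_submetric_le:
  assumes "0 < \<epsilon>" "S \<subseteq> mspace X" "mspace X \<noteq> {}" "i \<in> mspace X \<rightarrow> S"
    and d: "\<And>x. x \<in> mspace X \<Longrightarrow> mdist X (i x) x \<le> \<epsilon> / 2"
    and f: "\<And>x. x \<in> mspace X \<Longrightarrow> \<bar>f (i x) - f x\<bar> \<le> \<epsilon>"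
  shows "dGH0 (X, f) (submetric X S, restrict f S) \<le> \<epsilon>"
proof (rule dGH0_le[where i = i and j = id])
  interpret Metric_space "mspace X" "mdist X"
    by simp
  have S: "S \<inter> mspace X = S"
    using assms(2) by blast
  have i: "i x \<in> S" "i x \<in> mspace X" if "x \<in> mspace X" for x
    using that assms(2,4) by auto
  show "mspace (submetric X S) \<noteq> {}"
    using i assms(3) by (auto simp: S)
  \<comment> \<open>The first two triangle inequalities bound the new distance by the old one, the
    last two the old by the new.\<close>
  have "\<bar>mdist X (i x) (i x') - mdist X x x'\<bar> \<le> \<epsilon>" if "x \<in> mspace X" "x' \<in> mspace X" for x x'
    using d[of x] d[of x'] triangle[of "i x" x "i x'"] triangle[of x x' "i x'"]
      triangle[of x "i x" x'] triangle[of "i x" "i x'" x'] i that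
      commute[of x "i x"] commute[of x' "i x'"] by auto
  \<comment> \<open>The map \<open>i\<close> may move points of \<open>S\<close>, but
    \<open>y\<close> itself still serves, because \<open>i y\<close> is close to it.\<close>
  moreover have "\<exists>x\<in>mspace X. mdist X (i x) y \<le> \<epsilon>" if "y \<in> S" for y
    using d[of y] that assms(1,2) by (intro bexI[of _ y]) auto
  ultimately show "eps_isometry \<epsilon> X (submetric X S) i"
    using i by (auto simp: eps_isometry_def)
  have "\<exists>y\<in>S. mdist X y x \<le> \<epsilon>" if "x \<in> mspace X" for x
    using d[OF that] i[OF that] assms(1) by (intro bexI[of _ "i x"]) auto
  then show "eps_isometry \<epsilon> (submetric X S) X id"
    using assms(1) by (auto simp: eps_isometry_def S dest: subsetD[OF assms(2)])
  show "\<bar>restrict f S (i x) - f x\<bar> \<le> \<epsilon>" if "x \<in> mspace X" for x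
    using f i that by simp
qed (use assms in auto)

theorem corollary3:
  fixes \<sigma> :: "real \<Rightarrow> real"
  assumes "activation \<sigma>" and "sigmoidal_type \<sigma>"
  shows "dense_in_GH0 (shallow_net \<sigma> (F_fin :: 'a dfun set))"
proof -
  let ?N = "shallow_net \<sigma> (F_fin :: 'a dfun set)"
  have sub: "?N \<subseteq> all_cont"
    using assms(1) by (rule shallow_net_subset_all_cont)
  have approx: "\<exists>q\<in>?N. dGH0 p q < r" if p: "p \<in> all_cont" and r: "0 < r" for p r
  proof -
    obtain X f where Xf: "p = (X, f)" "X \<in> compact_spaces" "f \<in> cont_fun X"
      using p by (auto simp: all_cont_def)
    have ne: "mspace X \<noteq> {}"
      using Xf(2) by (simp add: compact_spaces_def)
    \<comment> \<open>The estimate is applied with \<epsilon> equal to \<open>r / 2\<close>, hence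
      displacement \<open>r / 4\<close>; the result \<open>r / 2\<close> is strictly below
      \<open>r\<close>.\<close>
    obtain S i where S: "finite S" "S \<subseteq> mspace X" "i \<in> mspace X \<rightarrow> S"
      and d: "\<And>x. x \<in> mspace X \<Longrightarrow> mdist X (i x) x < r / 4"
      and v: "\<And>x. x \<in> mspace X \<Longrightarrow> \<bar>f (i x) - f x\<bar> < r / 4"
      using finite_approximation_compact_space[OF Xf(2,3), of "r / 4"] r by auto
    have "S \<inter> mspace X = S" "S \<noteq> {}"
      using S ne by auto
    then have "(submetric X S, restrict f S) \<in> ?N"
      using S(1) by (intro shallow_net_F_fin_finite assms) auto
    moreover have "dGH0 (X, f) (submetric X S, restrict f S) \<le> r / 2"
      using S ne r by (intro dGH0_submetric_le[where i = i]) (auto dest: d v)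
    ultimately show ?thesis
      using r Xf(1) by (intro bexI[of _ "(submetric X S, restrict f S)"]) auto
  qed
  \<comment> \<open>By definition an open set around \<open>p\<close> contains a whole ball centred
    at \<open>p\<close>, so approximation within every radius suffices.\<close>
  have "p \<in> GH0_topology closure_of ?N" if p: "p \<in> all_cont" for p
    unfolding in_closure_of topspace_GH0_topology openin_GH0_topology
  proof (intro conjI allI impI p)
    fix U assume "p \<in> U \<and> GH0_open U"
    then obtain r where "0 < r" "{q \<in> all_cont. dGH0 p q < r} \<subseteq> U"
      unfolding GH0_open_def by blast
    then show "\<exists>q. q \<in> ?N \<and> q \<in> U"
      using approx[OF p, of r] sub by blast
  qed
  then have "GH0_topology closure_of ?N = all_cont"
    using closure_of_subset_topspace[of GH0_topology ?N] by (auto simp: topspace_GH0_topology)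
  then show ?thesis
    using sub by (simp add: dense_in_GH0_def)
qed

end
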